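(* The class of Banach spaces with the infinite tree property admits a submetric characterization in terms of the infinite diamond $D_\omega$ with the following set $S\subset D_\omega\times D_\omega$ of active pairs: a pair $(x,y)$ is active (that is, $(x,y)\in S$) if and only if it is a pair of vertices of a quadrilateral introduced in one of the steps of the construction of $D_\omega$. That is, for every Banach space $X$ the following two conditions are equivalent: (i) $X$ has the infinite tree property. (ii) There exist a constant $0<C<\infty$ and an embedding (injective map) $f:D_\omega\to X$ such that $$d_{D_\omega}(x,y)\le\|f(x)-f(y)\|\le C\,d_{D_\omega}(x,y)\qquad\text{for all }(x,y)\in S.$$
   Context: Infinite diamond. The diamond graph $D_0$ has two vertices joined by an edge of length $1$. For $n\ge 1$, $D_n$ is obtained from $D_{n-1}$ (all of whose edges have length $2^{-(n-1)}$) as follows: each edge $uv$ of $D_{n-1}$ is replaced by a quadrilateral $u,a,v,b$, where $a,b$ are two new vertices (different for different edges), with edges $ua, av, vb, bu$ of length $2^{-n}$ each. These are the quadrilaterals introduced at step $n$; the pairs of vertices of a quadrilateral include the diagonal pairs $\{u,v\}$ and $\{a,b\}$. The vertex set $V(D_n)$ carries the shortest path metric $d_{D_n}$. We regard $V(D_n)$ as a subset of $V(D_{n+1})$; this inclusion is isometric. $D_\omega$ is the metric space $\bigcup_{n=0}^\infty V(D_n)$ with metric $d_{D_\omega}(x,y)=d_{D_n}(x,y)$ for any $n$ with $x,y\in V(D_n)$. Infinite tree property. For $\delta>0$, a sequence $\{x_i\}_{i=1}^\infty$ in a Banach space $X$ is called a $\delta$-tree if for all $i\ge 1$ one has $x_i=\frac12(x_{2i}+x_{2i+1})$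 and $\|x_{2i}-x_i\|=\|x_{2i+1}-x_i\|\ge\delta$. $X$ has the infinite tree property if it contains a bounded $\delta$-tree for some $\delta>0$. An embedding $f$ of a metric space $T$ with a marked set $S\subset T\times T$ of active pairs into a Banach space, satisfying the two-sided inequality in (ii) for all active pairs, is called a partially bilipschitz embedding. *)

theory Defs
  imports "HOL-Analysis.Analysis"
begin

text \<open>
  \<open>Mid u v s\<close>, for \<open>s\<close> ranging over \<open>bool\<close>, are the two new vertices by which the edge \<open>uv\<close> is
  replaced.  Only the terms in \<open>diamond_verts n\<close> for some \<open>n\<close> are vertices of a diamond graph; the
  other terms of this type are junk.
\<close>

datatype vertex = Bottom | Top | Mid vertex vertex bool

text \<open>
  The edges are undirected, but every edge is listed in exactly one orientation, so that
  \<open>Mid u v s\<close> is determined by the edge.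
\<close>

primrec diamond_edges :: "nat \<Rightarrow> (vertex \<times> vertex) set" where
  "diamond_edges 0 = {(Bottom, Top)}"
| "diamond_edges (Suc n) =
     (\<Union>(u, v) \<in> diamond_edges n. \<Union>s. {(u, Mid u v s), (Mid u v s, v)})"

primrec diamond_verts :: "nat \<Rightarrow> vertex set" where
  "diamond_verts 0 = {Bottom, Top}"
| "diamond_verts (Suc n) =
     diamond_verts n \<union> (\<Union>(u, v) \<in> diamond_edges n. {Mid u v False, Mid u v True})"

definition diamond_adj :: "nat \<Rightarrow> (vertex \<times> vertex) set" where
  "diamond_adj n = diamond_edges n \<union> (diamond_edges n)\<inverse>"

text \<open>
  All edges at stage \<open>n\<close> have length \<open>1 / 2 ^ n\<close>, so the shortest path metric is the least number
  of edges of a walk from \<open>x\<close> to \<open>y\<close>, divided by \<open>2 ^ n\<close>.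
\<close>

definition diamond_dist :: "nat \<Rightarrow> vertex \<Rightarrow> vertex \<Rightarrow> real" where
  "diamond_dist n x y = real (LEAST k. (x, y) \<in> diamond_adj n ^^ k) / 2 ^ n"

definition D_omega :: "vertex set" where
  "D_omega = (\<Union>n. diamond_verts n)"

text \<open>
  Any stage containing both points gives the same value; see \<open>D_omega_dist_eq\<close> below.
\<close>

definition D_omega_dist :: "vertex \<Rightarrow> vertex \<Rightarrow> real" where
  "D_omega_dist x y = diamond_dist (LEAST n. x \<in> diamond_verts n \<and> y \<in> diamond_verts n) x y"

definition quadrilateral :: "vertex \<Rightarrow> vertex \<Rightarrow> vertex set" where
  "quadrilateral u v = {u, Mid u v False, v, Mid u v True}"

definition active_pairs :: "(vertex \<times> vertex) set" where
  "active_pairs =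
     {(x, y). x \<noteq> y \<and> (\<exists>n. \<exists>(u, v) \<in> diamond_edges n. x \<in> quadrilateral u v \<and> y \<in> quadrilateral u v)}"

text \<open>Sequences are indexed from \<open>1\<close>; the value \<open>x 0\<close> is irrelevant.\<close>

definition delta_tree :: "real \<Rightarrow> (nat \<Rightarrow> 'a::real_normed_vector) \<Rightarrow> bool" where
  "delta_tree \<delta> x \<longleftrightarrow>
     (\<forall>i\<ge>1. x i = (1 / 2) *\<^sub>R (x (2 * i) + x (2 * i + 1)) \<and>
            norm (x (2 * i) - x i) = norm (x (2 * i + 1) - x i) \<and>
            norm (x (2 * i + 1) - x i) \<ge> \<delta>)"

definition infinite_tree_property :: "'a::banach itself \<Rightarrow> bool" where
  "infinite_tree_property _ \<longleftrightarrow>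
     (\<exists>\<delta>>0. \<exists>x :: nat \<Rightarrow> 'a. delta_tree \<delta> x \<and> bounded (x ` {1..}))"

primrec birth :: "vertex \<Rightarrow> nat" where
  "birth Bottom = 0"
| "birth Top = 0"
| "birth (Mid u v s) = Suc (max (birth u) (birth v))"

lemma birth_edge: "(u, v) \<in> diamond_edges n \<Longrightarrow> max (birth u) (birth v) = n"
proof (induction n arbitrary: u v)
  case (Suc n)
  then obtain a b s where ab: "(a, b) \<in> diamond_edges n"
    and uv: "(u, v) = (a, Mid a b s) \<or> (u, v) = (Mid a b s, b)"
    by auto
  then show ?case using Suc.IH[OF ab] by auto
qed auto

lemma birth_vert: "x \<in> diamond_verts n \<Longrightarrow> birth x \<le> n"
proof (induction n)
  case (Suc n)
  then show ?case using birth_edge by fastforce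
qed auto

lemma Mid_fresh: "(u, v) \<in> diamond_edges n \<Longrightarrow> Mid u v s \<notin> diamond_verts n"
  using birth_edge[of u v n] birth_vert[of "Mid u v s" n] by auto

lemma Mid_vert: "(u, v) \<in> diamond_edges n \<Longrightarrow> Mid u v s \<in> diamond_verts (Suc n)"
  by (cases s) force+

lemma edge_verts: "(u, v) \<in> diamond_edges n \<Longrightarrow> u \<in> diamond_verts n \<and> v \<in> diamond_verts n"
proof (induction n arbitrary: u v)
  case (Suc n)
  then obtain a b s where ab: "(a, b) \<in> diamond_edges n"
    and uv: "(u, v) = (a, Mid a b s) \<or> (u, v) = (Mid a b s, b)"
    by auto
  then show ?case using Suc.IH[OF ab] Mid_vert[OF ab, of s] by auto
qed auto

lemma diamond_verts_mono: "m \<le> n \<Longrightarrow> diamond_verts m \<subseteq> diamond_verts n"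
  by (rule lift_Suc_mono_le[of diamond_verts]) auto

lemma adj_sym: "(x, y) \<in> diamond_adj n \<Longrightarrow> (y, x) \<in> diamond_adj n"
  by (auto simp: diamond_adj_def)

lemma walk_sym: "(x, y) \<in> diamond_adj n ^^ k \<Longrightarrow> (y, x) \<in> diamond_adj n ^^ k"
proof (induction k arbitrary: y)
  case (Suc k)
  then show ?case by (meson adj_sym relpow_Suc_E relpow_Suc_I2)
qed auto

lemma adj_MidI:
  assumes "(u, v) \<in> diamond_edges n"
  shows "(u, Mid u v s) \<in> diamond_adj (Suc n)" "(Mid u v s, v) \<in> diamond_adj (Suc n)"
  using assms by (force simp: diamond_adj_def)+

lemma walk_double: "(x, y) \<in> diamond_adj n ^^ k \<Longrightarrow> (x, y) \<in> diamond_adj (Suc n) ^^ (2 * k)"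
proof (induction k arbitrary: y)
  case (Suc k)
  then obtain z where z: "(x, z) \<in> diamond_adj n ^^ k" "(z, y) \<in> diamond_adj n"
    by (meson relpow_Suc_E)
  then have "\<exists>w. (z, w) \<in> diamond_adj (Suc n) \<and> (w, y) \<in> diamond_adj (Suc n)"
    using adj_MidI adj_sym unfolding diamond_adj_def[of n] by blast
  then obtain w where "(z, w) \<in> diamond_adj (Suc n)" "(w, y) \<in> diamond_adj (Suc n)" by blast
  with Suc.IH[OF z(1)] show ?case by (auto intro: relpow_Suc_I)
qed auto

lemma two_steps:
  assumes "x \<in> diamond_verts n" "(x, w) \<in> diamond_adj (Suc n)" "(w, z) \<in> diamond_adj (Suc n)"
  shows "z = x \<or> (x, z) \<in> diamond_adj n"
proof -
  have nbr: "\<exists>a b s. (a, b) \<in> diamond_edges n \<and>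
      ((p = Mid a b s \<and> q \<in> {a, b}) \<or> (q = Mid a b s \<and> p \<in> {a, b}))"
    if "(p, q) \<in> diamond_adj (Suc n)" for p q
    using that by (auto simp: diamond_adj_def)
  obtain a b s where ab: "(a, b) \<in> diamond_edges n" "w = Mid a b s" "x \<in> {a, b}"
    using nbr[OF assms(2)] Mid_fresh assms(1) by blast
  have "z \<in> {a, b}"
    using nbr[OF assms(3)] ab Mid_fresh edge_verts by blast
  with ab show ?thesis by (auto simp: diamond_adj_def)
qed

lemma adj_new:
  assumes "x \<in> diamond_verts n" "(x, w) \<in> diamond_adj (Suc n)"
  shows "w \<notin> diamond_verts n"
  using assms Mid_fresh unfolding diamond_adj_def by auto

lemma adj_old:
  assumes "x \<in> diamond_verts n" "(x, z) \<in> diamond_adj n"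
  shows "z \<in> diamond_verts n"
  using assms edge_verts unfolding diamond_adj_def by auto

lemma walk_halve:
  assumes "x \<in> diamond_verts n" "y \<in> diamond_verts n" "(x, y) \<in> diamond_adj (Suc n) ^^ k"
  shows "\<exists>j. 2 * j \<le> k \<and> (x, y) \<in> diamond_adj n ^^ j"
  using assms
proof (induction k arbitrary: x rule: less_induct)
  case (less k)
  consider "k = 0" | "k = 1" | k' where "k = Suc (Suc k')"
    by (metis One_nat_def not0_implies_Suc)
  then show ?case
  proof cases
    case 1
    then show ?thesis using less.prems by auto
  next
    case 2
    then show ?thesis using less.prems adj_new by auto
  next
    case 3
    then obtain w z where wz: "(x, w) \<in> diamond_adj (Suc n)" "(w, z) \<in> diamond_adj (Suc n)"
      "(z, y) \<in> diamond_adj (Suc n) ^^ k'"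
      using less.prems(3) by (metis relpow_Suc_D2)
    have xz: "z = x \<or> (x, z) \<in> diamond_adj n"
      by (rule two_steps[OF less.prems(1) wz(1,2)])
    then have "z \<in> diamond_verts n"
      using less.prems(1) adj_old by blast
    then obtain j where j: "2 * j \<le> k'" "(z, y) \<in> diamond_adj n ^^ j"
      using less.IH[of k' z] less.prems(2) wz(3) 3 by auto
    from xz show ?thesis
    proof
      assume "z = x"
      then show ?thesis using j 3 by (intro exI[of _ j]) auto
    next
      assume "(x, z) \<in> diamond_adj n"
      then have "(x, y) \<in> diamond_adj n ^^ Suc j" using j by (meson relpow_Suc_I2)
      then show ?thesis using j 3 by (intro exI[of _ "Suc j"]) auto
    qed
  qed
qed

lemma connected_Bottom: "x \<in> diamond_verts n \<Longrightarrow> \<exists>k. (Bottom, x) \<in> diamond_adj n ^^ k"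
proof (induction n arbitrary: x)
  case 0
  then have "x = Bottom \<or> (Bottom, x) \<in> diamond_adj 0" by (auto simp: diamond_adj_def)
  then show ?case using relpow_0_I[of Bottom "diamond_adj 0"] relpow_1[of "diamond_adj 0"] by blast
next
  case (Suc n)
  have old: "\<exists>k. (Bottom, z) \<in> diamond_adj (Suc n) ^^ k" if "z \<in> diamond_verts n" for z
    using Suc.IH[OF that] walk_double by blast
  from Suc.prems consider "x \<in> diamond_verts n"
    | u v s where "(u, v) \<in> diamond_edges n" "x = Mid u v s"
    by auto
  then show ?case
  proof cases
    case 2
    obtain k where "(Bottom, u) \<in> diamond_adj (Suc n) ^^ k"
      using old edge_verts[OF 2(1)] by blast
    then show ?thesis using relpow_Suc_I[OF _ adj_MidI(1)[OF 2(1), of s]] 2(2) by blast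
  qed (rule old)
qed

lemma connected_diamond:
  assumes "x \<in> diamond_verts n" "y \<in> diamond_verts n"
  shows "\<exists>k. (x, y) \<in> diamond_adj n ^^ k"
proof -
  obtain k where "(x, Bottom) \<in> diamond_adj n ^^ k"
    using connected_Bottom[OF assms(1)] walk_sym by blast
  moreover obtain l where "(Bottom, y) \<in> diamond_adj n ^^ l"
    using connected_Bottom[OF assms(2)] by blast
  ultimately have "(x, y) \<in> diamond_adj n ^^ (k + l)" by (auto simp: relpow_add)
  then show ?thesis ..
qed

lemma diamond_dist_Suc:
  assumes "x \<in> diamond_verts n" "y \<in> diamond_verts n"
  shows "diamond_dist (Suc n) x y = diamond_dist n x y"
proof -
  let ?k = "LEAST k. (x, y) \<in> diamond_adj n ^^ k"
  have walk: "(x, y) \<in> diamond_adj n ^^ ?k"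
    using connected_diamond[OF assms] by (rule LeastI_ex)
  have "(LEAST k. (x, y) \<in> diamond_adj (Suc n) ^^ k) = 2 * ?k"
  proof (rule Least_equality)
    show "(x, y) \<in> diamond_adj (Suc n) ^^ (2 * ?k)" by (rule walk_double[OF walk])
  next
    fix l assume "(x, y) \<in> diamond_adj (Suc n) ^^ l"
    then obtain j where "2 * j \<le> l" "(x, y) \<in> diamond_adj n ^^ j"
      using walk_halve[OF assms] by blast
    then show "2 * ?k \<le> l"
      using Least_le[of "\<lambda>k. (x, y) \<in> diamond_adj n ^^ k" j] by linarith
  qed
  then show ?thesis by (simp add: diamond_dist_def)
qed

lemma diamond_dist_isometric:
  assumes "m \<le> n" "x \<in> diamond_verts m" "y \<in> diamond_verts m"
  shows "diamond_dist n x y = diamond_dist m x y"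
  using assms(1)
proof (induction n rule: dec_induct)
  case (step n)
  then show ?case
    using diamond_dist_Suc[of x n y] diamond_verts_mono[of m n] assms(2,3) by auto
qed auto

theorem D_omega_dist_eq:
  assumes "x \<in> diamond_verts n" "y \<in> diamond_verts n"
  shows "D_omega_dist x y = diamond_dist n x y"
proof -
  let ?P = "\<lambda>n. x \<in> diamond_verts n \<and> y \<in> diamond_verts n"
  have "?P (LEAST n. ?P n)" "(LEAST n. ?P n) \<le> n"
    using assms LeastI[of ?P n] Least_le[of ?P n] by auto
  then show ?thesis
    unfolding D_omega_dist_def using diamond_dist_isometric[of "LEAST n. ?P n" n x y] by auto
qed

lemma diamond_dist_commute: "diamond_dist n x y = diamond_dist n y x"
proof -
  have "(\<lambda>k. (x, y) \<in> diamond_adj n ^^ k) = (\<lambda>k. (y, x) \<in> diamond_adj n ^^ k)"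
    using walk_sym by blast
  then show ?thesis by (simp add: diamond_dist_def)
qed

theorem Metric_space_D_omega: "Metric_space D_omega D_omega_dist"
proof
  have common: "\<exists>n. F \<subseteq> diamond_verts n" if "finite F" "F \<subseteq> D_omega" for F
    using that
  proof (induction F rule: finite_induct)
    case (insert x F)
    then obtain m n where "F \<subseteq> diamond_verts m" "x \<in> diamond_verts n"
      by (auto simp: D_omega_def)
    then have "insert x F \<subseteq> diamond_verts (max m n)"
      using diamond_verts_mono[of m "max m n"] diamond_verts_mono[of n "max m n"] by auto
    then show ?case ..
  qed auto
  show "0 \<le> D_omega_dist x y" for x y
    by (simp add: D_omega_dist_def diamond_dist_def)
  show "D_omega_dist x y = D_omega_dist y x" for x y
    unfolding D_omega_dist_def using diamond_dist_commute by (simp add: conj_commute)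
  show "D_omega_dist x y = 0 \<longleftrightarrow> x = y" if xyz: "x \<in> D_omega" "y \<in> D_omega" for x y
  proof -
    obtain n where n: "x \<in> diamond_verts n" "y \<in> diamond_verts n"
      using common[of "{x, y}"] xyz by auto
    have "(x, y) \<in> diamond_adj n ^^ (LEAST k. (x, y) \<in> diamond_adj n ^^ k)"
      using connected_diamond[OF n] by (rule LeastI_ex)
    then have "diamond_dist n x y = 0 \<Longrightarrow> x = y"
      by (simp add: diamond_dist_def)
    moreover have "(LEAST k. (x, x) \<in> diamond_adj n ^^ k) = 0"
      by (rule Least_eq_0) simp
    ultimately show ?thesis
      using D_omega_dist_eq[OF n] by (auto simp: diamond_dist_def)
  qed
  show "D_omega_dist x z \<le> D_omega_dist x y + D_omega_dist y z"
    if xyz: "x \<in> D_omega" "y \<in> D_omega" "z \<in> D_omega" for x y z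
  proof -
    obtain n where n: "x \<in> diamond_verts n" "y \<in> diamond_verts n" "z \<in> diamond_verts n"
      using common[of "{x, y, z}"] xyz by auto
    let ?k = "LEAST k. (x, y) \<in> diamond_adj n ^^ k"
    let ?l = "LEAST k. (y, z) \<in> diamond_adj n ^^ k"
    have "(x, y) \<in> diamond_adj n ^^ ?k" "(y, z) \<in> diamond_adj n ^^ ?l"
      using LeastI_ex[OF connected_diamond[OF n(1,2)]] LeastI_ex[OF connected_diamond[OF n(2,3)]] by auto
    then have "(x, z) \<in> diamond_adj n ^^ (?k + ?l)" by (auto simp: relpow_add)
    then have "(LEAST k. (x, z) \<in> diamond_adj n ^^ k) \<le> ?k + ?l" by (rule Least_le)
    then have "diamond_dist n x z \<le> diamond_dist n x y + diamond_dist n y z"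
      by (simp add: diamond_dist_def divide_right_mono flip: add_divide_distrib of_nat_add)
    then show ?thesis using D_omega_dist_eq n by simp
  qed
qed

end

theory Submission
  imports Defs
begin

text \<open>
  Both directions pass through the slopes \<open>2 ^ n *\<^sub>R (f v - f u)\<close> of \<open>f\<close> along the edges \<open>uv\<close> of
  the \<open>n\<close>th diamond: the slope of \<open>uv\<close> is the average of the slopes of \<open>ua\<close> and \<open>av\<close>.

  Given \<open>f\<close>, the slopes of \<open>ua\<close> and \<open>ub\<close> are at distance at least \<open>2\<close>, so one of them is at distance
  at least \<open>1\<close> from the slope of \<open>uv\<close>; always descending through that new vertex gives a bounded
  \<open>1\<close>-tree.

  Given a bounded tree, a translate of it stays away from \<open>0\<close>; prescribing its members as slopes,
  with the two children in opposite order on the two sides of each quadrilateral, gives a map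
  satisfying the two-sided inequality, which need not be injective.  Adding \<open>t *\<^sub>R h x *\<^sub>R e\<close> repairs
  this, for an injective real function \<open>h\<close> that is Lipschitz on active pairs and a small \<open>t\<close> outside
  a countable set.  The values of \<open>h\<close> are dyadic rationals with pairwise different denominators.
\<close>

section \<open>Active pairs\<close>

lemma edge_neq: "(u, v) \<in> diamond_edges n \<Longrightarrow> u \<noteq> v"
proof (cases n)
  case (Suc m)
  assume "(u, v) \<in> diamond_edges n"
  then obtain a b s where "(a, b) \<in> diamond_edges m"
    "(u, v) = (a, Mid a b s) \<or> (u, v) = (Mid a b s, b)"
    using Suc by auto
  then show ?thesis using Mid_fresh[of a b m s] edge_verts[of a b m] by (metis prod.inject)
qed auto

lemma D_omega_dist_edge:
  assumes "(u, v) \<in> diamond_edges n"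
  shows "D_omega_dist u v = 1 / 2 ^ n"
proof -
  have "(LEAST k. (u, v) \<in> diamond_adj n ^^ k) = 1"
  proof (rule Least_equality)
    show "(u, v) \<in> diamond_adj n ^^ 1"
      using assms by (simp add: diamond_adj_def)
    show "1 \<le> k" if "(u, v) \<in> diamond_adj n ^^ k" for k
      using that edge_neq[OF assms] by (cases k) auto
  qed
  then show ?thesis
    using D_omega_dist_eq[of u n v] edge_verts[OF assms] by (simp add: diamond_dist_def)
qed

lemma D_omega_dist_Mid:
  assumes "(u, v) \<in> diamond_edges n"
  shows "D_omega_dist (Mid u v False) (Mid u v True) = 1 / 2 ^ n"
proof -
  let ?a = "Mid u v False" and ?b = "Mid u v True"
  \<comment> \<open>Every edge of stage \<open>Suc n\<close> has an endpoint in
    \<open>diamond_verts n\<close>, and both of these vertices lie outside it.\<close>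
  have nadj: "(?a, ?b) \<notin> diamond_adj (Suc n)"
    using Mid_fresh edge_verts unfolding diamond_adj_def by fastforce
  have "(LEAST k. (?a, ?b) \<in> diamond_adj (Suc n) ^^ k) = 2"
  proof (rule Least_equality)
    show "(?a, ?b) \<in> diamond_adj (Suc n) ^^ 2"
      using relcompI[OF adj_sym[OF adj_MidI(1)] adj_MidI(1), OF assms assms]
      by (simp add: numeral_2_eq_2)
    show "2 \<le> k" if k: "(?a, ?b) \<in> diamond_adj (Suc n) ^^ k" for k
    proof (rule ccontr)
      assume "\<not> 2 \<le> k"
      then have "k = 0 \<or> k = 1" by auto
      with k nadj show False by auto
    qed
  qed
  then show ?thesis
    using D_omega_dist_eq[OF Mid_vert Mid_vert, OF assms assms] by (simp add: diamond_dist_def)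
qed

lemma edge_active: "(u, v) \<in> diamond_edges n \<Longrightarrow> (u, v) \<in> active_pairs"
  using edge_neq[of u v n] unfolding active_pairs_def quadrilateral_def by blast

lemma Mid_active: "(u, v) \<in> diamond_edges n \<Longrightarrow> (Mid u v False, Mid u v True) \<in> active_pairs"
  unfolding active_pairs_def quadrilateral_def by blast

text \<open>The four sides of a quadrilateral are edges of the next stage, so up to symmetry only
  edges and the diagonals between new vertices remain.\<close>

lemma active_pairs_induct [consumes 1, case_names sym edge Mid]:
  assumes "(x, y) \<in> active_pairs"
    and sym: "\<And>x y. P x y \<Longrightarrow> P y x"
    and edge: "\<And>u v n. (u, v) \<in> diamond_edges n \<Longrightarrow> P u v"
    and Mid: "\<And>u v n. (u, v) \<in> diamond_edges n \<Longrightarrow> P (Mid u v False) (Mid u v True)"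
  shows "P x y"
proof -
  obtain n u v where uv: "(u, v) \<in> diamond_edges n" and "x \<noteq> y"
    and xy: "x \<in> quadrilateral u v" "y \<in> quadrilateral u v"
    using assms(1) by (auto simp: active_pairs_def)
  have side: "P u (Mid u v s)" "P (Mid u v s) v" for s
  proof -
    have "(u, Mid u v s) \<in> diamond_edges (Suc n)" "(Mid u v s, v) \<in> diamond_edges (Suc n)"
      using uv by auto
    from this[THEN edge] show "P u (Mid u v s)" "P (Mid u v s) v" .
  qed
  note pairs = side edge[OF uv] Mid[OF uv]
  show ?thesis
    using xy \<open>x \<noteq> y\<close> pairs pairs[THEN sym] unfolding quadrilateral_def by auto
qed

section \<open>From embeddings to trees\<close>

text \<open>
  \<open>c u v\<close> selects the new vertex through which the system of edges descends from the edge \<open>uv\<close>.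
\<close>

fun branch :: "(vertex \<Rightarrow> vertex \<Rightarrow> bool) \<Rightarrow> nat \<Rightarrow> vertex \<times> vertex" where
  "branch c i =
     (if i \<le> 1 then (Bottom, Top)
      else case branch c (i div 2) of (u, v) \<Rightarrow>
        if even i then (u, Mid u v (c u v)) else (Mid u v (c u v), v))"

declare branch.simps [simp del]

lemma branch_children:
  assumes "i \<ge> 1" "branch c i = (u, v)"
  shows "branch c (2 * i) = (u, Mid u v (c u v))"
    and "branch c (Suc (2 * i)) = (Mid u v (c u v), v)"
  using assms by (simp_all add: branch.simps[of c "2 * i"] branch.simps[of c "Suc (2 * i)"])

lemma branch_edge: "\<exists>n. branch c i \<in> diamond_edges n"
proof (induction i rule: less_induct)
  case (less i)
  show ?case
  proof (cases "i \<le> 1")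
    case True
    then have "branch c i \<in> diamond_edges 0" by (simp add: branch.simps)
    then show ?thesis ..
  next
    case False
    obtain u v where uv: "branch c (i div 2) = (u, v)" by fastforce
    then obtain n where "(u, v) \<in> diamond_edges n" using less[of "i div 2"] False by auto
    then have "branch c i \<in> diamond_edges (Suc n)"
      using False uv by (auto simp: branch.simps[of c i])
    then show ?thesis ..
  qed
qed

text \<open>By \<open>birth_edge\<close>, the exponent is the stage at which the edge \<open>uv\<close> appears.\<close>

definition slope :: "(vertex \<Rightarrow> 'a::real_normed_vector) \<Rightarrow> vertex \<times> vertex \<Rightarrow> 'a" where
  "slope f = (\<lambda>(u, v). (2 ^ max (birth u) (birth v)) *\<^sub>R (f v - f u))"

lemma slope_edge: "(u, v) \<in> diamond_edges n \<Longrightarrow> slope f (u, v) = (2 ^ n) *\<^sub>R (f v - f u)"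
  using birth_edge[of u v n] by (simp add: slope_def)

lemma slope_split:
  assumes "(u, v) \<in> diamond_edges n"
  shows "slope f (u, Mid u v s) = (2 * 2 ^ n) *\<^sub>R (f (Mid u v s) - f u)"
    and "slope f (u, v) = (1 / 2) *\<^sub>R (slope f (u, Mid u v s) + slope f (Mid u v s, v))"
proof -
  have "(u, Mid u v s) \<in> diamond_edges (Suc n)" "(Mid u v s, v) \<in> diamond_edges (Suc n)"
    using assms by auto
  note e = this[THEN slope_edge, of f]
  then show "slope f (u, Mid u v s) = (2 * 2 ^ n) *\<^sub>R (f (Mid u v s) - f u)" by simp
  show "slope f (u, v) = (1 / 2) *\<^sub>R (slope f (u, Mid u v s) + slope f (Mid u v s, v))"
    unfolding e slope_edge[OF assms] by (simp add: algebra_simps)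
qed

lemma far_from_center:
  fixes x y z :: "'a::real_normed_vector"
  assumes "norm (x - y) \<ge> 2"
  shows "norm (x - z) \<ge> 1 \<or> norm (y - z) \<ge> 1"
  using norm_triangle_ineq4[of "x - z" "y - z"] assms by auto

lemma tree_if_embedding:
  fixes f :: "vertex \<Rightarrow> 'a::banach"
  assumes f: "\<And>x y. (x, y) \<in> active_pairs \<Longrightarrow>
      D_omega_dist x y \<le> norm (f x - f y) \<and> norm (f x - f y) \<le> C * D_omega_dist x y"
  shows "infinite_tree_property TYPE('a)"
proof -
  have "\<exists>s. norm (slope f (u, Mid u v s) - slope f (u, v)) \<ge> 1"
    if uv: "(u, v) \<in> diamond_edges n" for u v n
  proof -
    have "slope f (u, Mid u v False) - slope f (u, Mid u v True)
        = (2 * 2 ^ n) *\<^sub>R (f (Mid u v False) - f (Mid u v True))"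
      unfolding slope_split(1)[OF uv] by (simp add: algebra_simps)
    then have "norm (slope f (u, Mid u v False) - slope f (u, Mid u v True))
        = 2 * 2 ^ n * norm (f (Mid u v False) - f (Mid u v True))"
      by simp
    moreover have "1 / 2 ^ n \<le> norm (f (Mid u v False) - f (Mid u v True))"
      using f[OF Mid_active[OF uv]] D_omega_dist_Mid[OF uv] by simp
    ultimately have "2 \<le> norm (slope f (u, Mid u v False) - slope f (u, Mid u v True))"
      by (simp add: field_simps)
    then show ?thesis using far_from_center by blast
  qed
  then obtain c where c: "\<And>u v n. (u, v) \<in> diamond_edges n \<Longrightarrow>
      norm (slope f (u, Mid u v (c u v)) - slope f (u, v)) \<ge> 1"
    by metis
  define x where "x i = slope f (branch c i)" for i
  have "delta_tree 1 x"
    unfolding delta_tree_def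
  proof (intro allI impI)
    fix i :: nat assume i: "i \<ge> 1"
    obtain u v where uv: "branch c i = (u, v)" by fastforce
    obtain n where n: "(u, v) \<in> diamond_edges n" using branch_edge[of c i] uv by auto
    have avg: "x i = (1 / 2) *\<^sub>R (x (2 * i) + x (2 * i + 1))"
      using slope_split(2)[OF n] branch_children[OF i uv] uv by (simp add: x_def)
    have far: "norm (x (2 * i) - x i) \<ge> 1"
      using c[OF n] branch_children[OF i uv] uv by (simp add: x_def)
    \<comment> \<open>The children lie symmetrically about \<open>x i\<close>, so the bound for the
      child chosen by \<open>c\<close> carries over to its sibling.\<close>
    have "x (2 * i + 1) - x i = - (x (2 * i) - x i)"
      unfolding avg by (simp add: algebra_simps flip: scaleR_add_left)
    then have "norm (x (2 * i) - x i) = norm (x (2 * i + 1) - x i)"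
      by (metis norm_minus_cancel)
    with avg far show "x i = (1 / 2) *\<^sub>R (x (2 * i) + x (2 * i + 1)) \<and>
        norm (x (2 * i) - x i) = norm (x (2 * i + 1) - x i) \<and>
        norm (x (2 * i + 1) - x i) \<ge> 1"
      by simp
  qed
  \<comment> \<open>The factor \<open>2 ^ n\<close> in the slope cancels the length of an edge of
    stage \<open>n\<close>.\<close>
  moreover have "norm (x i) \<le> C" for i
  proof -
    obtain u v where uv: "branch c i = (u, v)" by fastforce
    obtain n where n: "(u, v) \<in> diamond_edges n" using branch_edge[of c i] uv by auto
    have "norm (f v - f u) \<le> C / 2 ^ n"
      using f[OF edge_active[OF n]] D_omega_dist_edge[OF n] by (simp add: norm_minus_commute)
    then show ?thesis
      unfolding x_def uv slope_edge[OF n] norm_scaleR by (simp add: field_simps)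
  qed
  then have "bounded (x ` {1..})" by (auto simp: bounded_iff)
  ultimately show ?thesis
    unfolding infinite_tree_property_def by (intro exI[of _ 1]) auto
qed

section \<open>Maps with prescribed slopes\<close>

text \<open>
  \<open>end_index x False\<close> and \<open>end_index x True\<close> are the indices in the tree of the edges \<open>ux\<close> and \<open>xv\<close>
  that are created together with \<open>x = Mid u v s\<close>.  Of the two ends of an edge, the one born later
  is created together with the edge.
\<close>

primrec end_index :: "vertex \<Rightarrow> bool \<Rightarrow> nat" where
  "end_index Bottom t = 1"
| "end_index Top t = 1"
| "end_index (Mid u v s) t =
     2 * (if birth u < birth v then end_index v False else end_index u True) + of_bool (s \<noteq> t)"

text \<open>The same conditional occurs inside \<open>end_index\<close>, where it finds the index of
  the parent edge. Among edges, births tie only for the initial one, and both of its ends give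
  1.\<close>

definition edge_index :: "vertex \<Rightarrow> vertex \<Rightarrow> nat" where
  "edge_index u v = (if birth u < birth v then end_index v False else end_index u True)"

lemma edge_index_simps [simp]:
  "edge_index Bottom Top = 1"
  "edge_index u (Mid u v s) = 2 * edge_index u v + of_bool s"
  "edge_index (Mid u v s) v = 2 * edge_index u v + of_bool (\<not> s)"
  by (auto simp: edge_index_def)

lemma edge_index_pos: "edge_index u v \<ge> 1"
proof -
  have "end_index x t \<ge> 1" for x t by (induction x arbitrary: t) auto
  then show ?thesis by (simp add: edge_index_def)
qed

primrec tree_map :: "(nat \<Rightarrow> 'a::real_vector) \<Rightarrow> vertex \<Rightarrow> 'a" where
  "tree_map x Bottom = 0"
| "tree_map x Top = x 1"
| "tree_map x (Mid u v s) =
     tree_map x u + (1 / 2 ^ birth (Mid u v s)) *\<^sub>R x (edge_index u (Mid u v s))"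

text \<open>\<open>tree_map\<close> prescribes only the slope from \<open>u\<close> to the new
  vertex; averaging then forces the slope of the other half to be the sibling.\<close>

lemma tree_map_edge:
  assumes avg: "\<And>i. i \<ge> 1 \<Longrightarrow> x i = (1 / 2) *\<^sub>R (x (2 * i) + x (2 * i + 1))"
    and "(u, v) \<in> diamond_edges n"
  shows "tree_map x v - tree_map x u = (1 / 2 ^ n) *\<^sub>R x (edge_index u v)"
  using assms(2)
proof (induction n arbitrary: u v)
  case (Suc n)
  then obtain a b s where ab: "(a, b) \<in> diamond_edges n"
    and uv: "(u, v) = (a, Mid a b s) \<or> (u, v) = (Mid a b s, b)"
    by auto
  let ?i = "edge_index a b" and ?r = "1 / 2 ^ Suc n :: real"
  have birth: "birth (Mid a b s) = Suc n" using birth_edge[OF ab] by simp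
  have "tree_map x b - tree_map x a = ?r *\<^sub>R (x (2 * ?i) + x (2 * ?i + 1))"
    unfolding Suc.IH[OF ab] avg[OF edge_index_pos] by simp
  then have "tree_map x b - tree_map x (Mid a b s) = ?r *\<^sub>R x (edge_index (Mid a b s) b)"
    using birth by (cases s) (simp_all add: algebra_simps)
  then show ?case using uv birth by auto
qed auto

text \<open>Both increments start at \<open>u\<close>, and the opposite order on the two sides gives
  them sibling indices, so the diagonal inherits the gap between siblings.\<close>

lemma tree_map_Mid:
  assumes "(u, v) \<in> diamond_edges n"
  shows "tree_map x (Mid u v False) - tree_map x (Mid u v True) =
    (1 / 2 ^ Suc n) *\<^sub>R (x (2 * edge_index u v) - x (2 * edge_index u v + 1))"
  using birth_edge[OF assms] by (simp add: algebra_simps)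

section \<open>An injective Lipschitz function\<close>

text \<open>These numbers become exponents of denominators in \<open>height\<close>. They must be
  distinct, and the code of a new vertex must exceed those of its parents by at least 2.\<close>

primrec code :: "vertex \<Rightarrow> nat" where
  "code Bottom = 0"
| "code Top = 1"
| "code (Mid u v s) = 2 * prod_encode (code u, code v) + of_bool s + 3"

lemma code_Mid_ge: "code (Mid u v s) \<ge> 2 * max (code u) (code v) + 3"
  using le_prod_encode_1[of "code u" "code v"] le_prod_encode_2[of "code v" "code u"] by auto

lemma inj_code: "inj code"
proof
  show "x = y" if "code x = code y" for x y
    using that
  proof (induction x arbitrary: y)
    case Bottom
    then show ?case by (cases y) auto
  next
    case Top
    then show ?case by (cases y) auto
  next
    case (Mid u v s)
    then obtain u' v' s' where y: "y = Mid u' v' s'" by (cases y) auto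
    have "2 * prod_encode (code u, code v) + of_bool s
        = 2 * prod_encode (code u', code v') + of_bool s'"
      using Mid.prems y by simp
    then have "prod_encode (code u, code v) = prod_encode (code u', code v') \<and> s = s'"
      by (cases s; cases s') (simp_all, presburger+)
    then show ?case using Mid.IH y by simp
  qed
qed

lemma birth_le_code: "2 * birth x \<le> code x"
proof (induction x)
  case (Mid u v s)
  then show ?case using code_Mid_ge[of u v s] by auto
qed auto

text \<open>Taking midpoints halves the increments along edges, as a Lipschitz bound requires; the
  correction stamps each vertex with its own denominator.\<close>

primrec height :: "vertex \<Rightarrow> real" where
  "height Bottom = 1"
| "height Top = 1 / 2"
| "height (Mid u v s) = (height u + height v) / 2 + 1 / 2 ^ code (Mid u v s)"

text \<open>Over the denominator \<open>2 ^ code (Mid u v s)\<close> the halved heights of the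
  parents still have even numerators, and the correction adds 1.\<close>

lemma height_odd_over_power: "\<exists>k::int. odd k \<and> height x = k / 2 ^ code x"
proof (induction x)
  case Bottom
  show ?case by (intro exI[of _ 1]) simp
next
  case Top
  show ?case by (intro exI[of _ 1]) simp
next
  case (Mid u v s)
  then obtain k l :: int where kl: "height u = k / 2 ^ code u" "height v = l / 2 ^ code v"
    by blast
  let ?c = "code (Mid u v s)"
  have c: "code u + 2 \<le> ?c" "code v + 2 \<le> ?c" using code_Mid_ge[of u v s] by auto
  obtain p q where p: "?c = code u + 2 + p" and q: "?c = code v + 2 + q"
    using c le_Suc_ex by blast
  have "height u / 2 = 2 * (k * 2 ^ p) / 2 ^ ?c" "height v / 2 = 2 * (l * 2 ^ q) / 2 ^ ?c"
    unfolding kl by (simp add: p power_add del: code.simps) (simp add: q power_add del: code.simps)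
  then have "height (Mid u v s) = of_int (2 * (k * 2 ^ p) + 2 * (l * 2 ^ q) + 1) / 2 ^ ?c"
    by (simp add: add_divide_distrib del: code.simps)
  then show ?case by (intro exI[of _ "2 * (k * 2 ^ p) + 2 * (l * 2 ^ q) + 1"]) simp
qed

lemma inj_height: "inj height"
proof
  have le: "code y \<le> code x" if "height x = height y" for x y
  proof (rule ccontr)
    assume "\<not> code y \<le> code x"
    then obtain p where p: "code y = code x + Suc p" using less_iff_Suc_add[of "code x" "code y"] by auto
    obtain k l :: int where "odd k" and kl: "height x = k / 2 ^ code x" "odd l" "height y = l / 2 ^ code y"
      using height_odd_over_power by metis
    \<comment> \<open>Clearing denominators makes the odd numerator \<open>l\<close> a multiple of
      2.\<close>
    then have "real_of_int l = real_of_int (k * 2 ^ Suc p)"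
      using that p by (simp add: field_simps power_add)
    then have "l = k * 2 ^ Suc p" by linarith
    then show False using \<open>odd l\<close> by simp
  qed
  show "x = y" if "height x = height y" for x y
    using le[OF that] le[OF that[symmetric]] inj_code by (simp add: inj_eq)
qed

text \<open>Subtracting \<open>1 / 4 ^ n\<close> makes the induction close: half of this bound plus
  a correction of at most \<open>1 / 4 ^ Suc n\<close>, by \<open>birth_le_code\<close>, is exactly
  the next bound.\<close>

lemma height_edge: "(u, v) \<in> diamond_edges n \<Longrightarrow> \<bar>height u - height v\<bar> \<le> 2 / 2 ^ n - 1 / 4 ^ n"
proof (induction n arbitrary: u v)
  case (Suc n)
  then obtain a b s where ab: "(a, b) \<in> diamond_edges n"
    and uv: "(u, v) = (a, Mid a b s) \<or> (u, v) = (Mid a b s, b)"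
    by auto
  let ?m = "Mid a b s"
  have "2 * Suc n \<le> code ?m"
    using birth_le_code[of ?m] birth_edge[OF ab] by simp
  then have "(2::real) ^ (2 * Suc n) \<le> 2 ^ code ?m" by (rule power_increasing) simp
  then have "(4::real) ^ Suc n \<le> 2 ^ code ?m" by (simp add: power_mult)
  then have m: "1 / 2 ^ code ?m \<le> 1 / (4::real) ^ Suc n" "0 < 1 / (2::real) ^ code ?m"
    by (simp_all add: frac_le del: code.simps)
  have h: "height ?m = (height a + height b) / 2 + 1 / 2 ^ code ?m" by simp
  have bound: "2 / 2 ^ Suc n - 1 / 4 ^ Suc n = (2 / 2 ^ n - 1 / 4 ^ n) / 2 + 1 / (4::real) ^ Suc n"
    by (simp add: field_simps)
  have "\<bar>p - r\<bar> \<le> K / 2 + e \<and> \<bar>r - q\<bar> \<le> K / 2 + e"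
    if "\<bar>p - q\<bar> \<le> K" "d \<le> e" "0 < d" "r = (p + q) / 2 + d" for p q r d e K :: real
    using that unfolding abs_le_iff by argo
  from this[OF Suc.IH[OF ab] m h] show ?case using uv unfolding bound by blast
qed auto

lemma height_lipschitz:
  assumes "(x, y) \<in> active_pairs"
  shows "\<bar>height x - height y\<bar> \<le> 2 * D_omega_dist x y"
  using assms
proof (induction rule: active_pairs_induct)
  case (sym x y)
  then show ?case
    using Metric_space.commute[OF Metric_space_D_omega, of x y] by simp
next
  case (edge u v n)
  have "(0::real) \<le> 1 / 4 ^ n" by simp
  with height_edge[OF edge] have "\<bar>height u - height v\<bar> \<le> 2 / 2 ^ n" by linarith
  then show ?case unfolding D_omega_dist_edge[OF edge] by simp
next
  case (Mid u v n)
  \<comment> \<open>The diagonal is estimated through \<open>u\<close>: each of the two sides uses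
    half of the allowed difference.\<close>
  have "\<bar>height u - height (Mid u v s)\<bar> \<le> 1 / 2 ^ n" for s
  proof -
    have "(u, Mid u v s) \<in> diamond_edges (Suc n)" using Mid by auto
    from height_edge[OF this] have "\<bar>height u - height (Mid u v s)\<bar> \<le> 1 / 2 ^ n - 1 / 4 ^ Suc n"
      by simp
    moreover have "(0::real) \<le> 1 / 4 ^ Suc n" by simp
    ultimately show ?thesis by linarith
  qed
  from this[of False] this[of True] show ?case
    unfolding D_omega_dist_Mid[OF Mid] by linarith
qed

section \<open>From trees to embeddings\<close>

lemma exists_injective_perturbation:
  fixes g :: "'b \<Rightarrow> 'a::real_normed_vector" and h :: "'b \<Rightarrow> real"
  assumes "countable (UNIV :: 'b set)" "inj h" "e \<noteq> 0" "\<epsilon> > 0"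
  shows "\<exists>t. 0 < t \<and> t < \<epsilon> \<and> inj (\<lambda>x. g x + (t * h x) *\<^sub>R e)"
proof -
  define B where "B x y = {t. x \<noteq> y \<and> g x + (t * h x) *\<^sub>R e = g y + (t * h y) *\<^sub>R e}" for x y
  have "countable (B x y)" for x y
  proof (rule countable_subset)
    \<comment> \<open>Subtracting the collision equations for \<open>r\<close> and \<open>t\<close>
      leaves a multiple of \<open>e\<close> that vanishes only if \<open>r = t\<close>. If
      \<open>B x y\<close> is empty, the value of \<open>THE\<close> does not matter.\<close>
    show "B x y \<subseteq> {THE t. t \<in> B x y}"
    proof
      fix t assume t: "t \<in> B x y"
      have "r = t" if r: "r \<in> B x y" for r
      proof -
        have "((r - t) * (h x - h y)) *\<^sub>R e =
            (g x + (r * h x) *\<^sub>R e - (g y + (r * h y) *\<^sub>R e))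
            - (g x + (t * h x) *\<^sub>R e - (g y + (t * h y) *\<^sub>R e))"
          by (simp add: algebra_simps)
        also have "\<dots> = 0" using r t by (simp add: B_def)
        finally show ?thesis using t \<open>e \<noteq> 0\<close> \<open>inj h\<close> by (auto simp: B_def inj_eq)
      qed
      with t have "(THE t. t \<in> B x y) = t" by blast
      then show "t \<in> {THE t. t \<in> B x y}" by simp
    qed
  qed simp
  then have "countable (\<Union>x. \<Union>y. B x y)" using assms(1) by blast
  moreover have "uncountable {0<..<\<epsilon>}" using \<open>\<epsilon> > 0\<close> by (simp add: uncountable_open_interval)
  ultimately obtain t where "t \<in> {0<..<\<epsilon>}" "t \<notin> (\<Union>x. \<Union>y. B x y)"
    by (meson countable_subset subsetI)
  then show ?thesis by (intro exI[of _ t]) (auto simp: B_def inj_def)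
qed

lemma embedding_if_large_tree:
  fixes x :: "nat \<Rightarrow> 'a::banach"
  assumes "\<delta> > 0" and tree: "delta_tree \<delta> x"
    and norm: "\<And>i. i \<ge> 1 \<Longrightarrow> 1 \<le> norm (x i) \<and> norm (x i) \<le> M"
  shows "\<exists>C (f :: vertex \<Rightarrow> 'a). 0 < C \<and> inj f \<and> (\<forall>(x, y) \<in> active_pairs.
      D_omega_dist x y \<le> norm (f x - f y) \<and> norm (f x - f y) \<le> C * D_omega_dist x y)"
proof -
  let ?d = D_omega_dist and ?g = "tree_map x"
  interpret Metric_space D_omega D_omega_dist by (rule Metric_space_D_omega)
  \<comment> \<open>A common lower constant for edges, whose slopes have norm at least 1, and
    diagonals, where half the gap between siblings is at least \<delta>.\<close>
  define m where "m = min 1 \<delta>"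
  have m: "0 < m" "m \<le> 1" "m \<le> \<delta>" using \<open>\<delta> > 0\<close> by (auto simp: m_def)
  have avg: "x i = (1 / 2) *\<^sub>R (x (2 * i) + x (2 * i + 1))" if "i \<ge> 1" for i
    using tree that unfolding delta_tree_def by blast
  have gap: "2 * \<delta> \<le> norm (x (2 * i) - x (2 * i + 1))" if "i \<ge> 1" for i
  proof -
    have "x (2 * i) - x (2 * i + 1) = 2 *\<^sub>R (x (2 * i) - x i)"
      unfolding avg[OF that] by (simp add: scaleR_diff_right scaleR_2)
    moreover have "norm (x (2 * i) - x i) = norm (x (2 * i + 1) - x i)"
        "norm (x (2 * i + 1) - x i) \<ge> \<delta>"
      using tree that unfolding delta_tree_def by blast+
    ultimately show ?thesis by simp
  qed
  have g: "m * ?d p q \<le> norm (?g p - ?g q) \<and> norm (?g p - ?g q) \<le> M * ?d p q"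
    if "(p, q) \<in> active_pairs" for p q
    using that
  proof (induction rule: active_pairs_induct)
    case (sym p q)
    then show ?case by (metis commute norm_minus_commute)
  next
    case (edge u v n)
    have "?g v - ?g u = (1 / 2 ^ n) *\<^sub>R x (edge_index u v)"
      using avg edge by (rule tree_map_edge)
    then have "norm (?g u - ?g v) = norm ((1 / 2 ^ n) *\<^sub>R x (edge_index u v))"
      by (metis norm_minus_commute)
    then have "norm (?g u - ?g v) = norm (x (edge_index u v)) / 2 ^ n" by simp
    then show ?case
      using norm[OF edge_index_pos[of u v]] m(2) unfolding D_omega_dist_edge[OF edge]
      by (simp add: divide_right_mono)
  next
    case (Mid u v n)
    let ?i = "edge_index u v"
    have eq: "norm (?g (Mid u v False) - ?g (Mid u v True))
        = norm (x (2 * ?i) - x (2 * ?i + 1)) / 2 / 2 ^ n"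
      unfolding tree_map_Mid[OF Mid] by simp
    have "m \<le> norm (x (2 * ?i) - x (2 * ?i + 1)) / 2"
      using gap[OF edge_index_pos[of u v]] m(3) by simp
    moreover have "norm (x (2 * ?i) - x (2 * ?i + 1)) / 2 \<le> M"
      using norm_triangle_ineq4[of "x (2 * ?i)" "x (2 * ?i + 1)"] norm[of "2 * ?i"]
        norm[of "2 * ?i + 1"] edge_index_pos[of u v] by linarith
    ultimately show ?case
      unfolding D_omega_dist_Mid[OF Mid] eq by (auto simp: field_simps)
  qed
  define e where "e = sgn (x 1)"
  have "x 1 \<noteq> 0" using norm[of 1] by auto
  then have e: "norm e = 1" "e \<noteq> 0" by (auto simp: e_def norm_sgn sgn_zero_iff)
  have "countable (UNIV :: vertex set)" using inj_code by (rule countableI)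
  \<comment> \<open>By \<open>height_lipschitz\<close>, \<open>t < m / 4\<close> keeps the
    perturbation within half of the lower estimate \<open>m * ?d p q\<close>.\<close>
  then obtain t where t: "0 < t" "t < m / 4" and inj: "inj (\<lambda>p. ?g p + (t * height p) *\<^sub>R e)"
    using exists_injective_perturbation[OF _ inj_height e(2), of "m / 4" ?g] m(1) by auto
  \<comment> \<open>The factor \<open>2 / m\<close> raises the surviving lower constant
    \<open>m / 2\<close> to 1.\<close>
  define f where "f p = (2 / m) *\<^sub>R (?g p + (t * height p) *\<^sub>R e)" for p
  have "inj f" using inj m(1) by (auto simp: f_def inj_def)
  moreover have "?d p q \<le> norm (f p - f q) \<and> norm (f p - f q) \<le> (2 * M / m + 1) * ?d p q"
    if pq: "(p, q) \<in> active_pairs" for p q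
  proof -
    let ?G = "?g p - ?g q" and ?H = "(t * (height p - height q)) *\<^sub>R e"
    have "f p - f q = (2 / m) *\<^sub>R (?G + ?H)" by (simp add: f_def algebra_simps)
    then have N: "m * norm (f p - f q) = 2 * norm (?G + ?H)" using m(1) by simp
    have H: "norm ?H \<le> m / 2 * ?d p q"
    proof -
      have "norm ?H = t * \<bar>height p - height q\<bar>" using e t by (simp add: abs_mult)
      also have "\<dots> \<le> m / 4 * (2 * ?d p q)"
        using height_lipschitz[OF pq] t by (intro mult_mono) auto
      finally show ?thesis by simp
    qed
    have "m * ?d p q \<le> m * norm (f p - f q)"
      unfolding N using g[OF pq] H norm_diff_ineq[of ?G ?H] by argo
    moreover have "m * norm (f p - f q) \<le> 2 * (M * ?d p q) + m * ?d p q"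
      unfolding N using g[OF pq] H norm_triangle_ineq[of ?G ?H] by argo
    moreover have "2 * (M * ?d p q) + m * ?d p q = m * ((2 * M / m + 1) * ?d p q)"
      using m(1) by (simp add: field_simps)
    ultimately show ?thesis using m(1) by (metis mult_le_cancel_left_pos)
  qed
  moreover have "0 < 2 * M / m + 1"
    using norm[of 1] m(1) by (simp add: add_nonneg_pos)
  ultimately show ?thesis by blast
qed

lemma delta_tree_translate:
  assumes "delta_tree \<delta> x"
  shows "delta_tree \<delta> (\<lambda>i. x i + z)"
  unfolding delta_tree_def
proof (intro allI impI)
  fix i :: nat assume "i \<ge> 1"
  then have i: "x i = (1 / 2) *\<^sub>R (x (2 * i) + x (2 * i + 1))"
      "norm (x (2 * i) - x i) = norm (x (2 * i + 1) - x i)" "norm (x (2 * i + 1) - x i) \<ge> \<delta>"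
    using assms unfolding delta_tree_def by blast+
  have "(1 / 2) *\<^sub>R ((x (2 * i) + z) + (x (2 * i + 1) + z))
      = (1 / 2) *\<^sub>R (x (2 * i) + x (2 * i + 1)) + z"
    by (simp add: algebra_simps flip: scaleR_add_left)
  then show "x i + z = (1 / 2) *\<^sub>R ((x (2 * i) + z) + (x (2 * i + 1) + z)) \<and>
      norm (x (2 * i) + z - (x i + z)) = norm (x (2 * i + 1) + z - (x i + z)) \<and>
      \<delta> \<le> norm (x (2 * i + 1) + z - (x i + z))"
    using i by simp
qed

lemma embedding_if_tree:
  assumes "infinite_tree_property TYPE('a::banach)"
  shows "\<exists>C (f :: vertex \<Rightarrow> 'a). 0 < C \<and> inj f \<and> (\<forall>(x, y) \<in> active_pairs.
      D_omega_dist x y \<le> norm (f x - f y) \<and> norm (f x - f y) \<le> C * D_omega_dist x y)"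
proof -
  obtain \<delta> and x :: "nat \<Rightarrow> 'a" where "\<delta> > 0" and tree: "delta_tree \<delta> x"
    and "bounded (x ` {1..})"
    using assms unfolding infinite_tree_property_def by blast
  then obtain M where M: "\<And>i. i \<ge> 1 \<Longrightarrow> norm (x i) \<le> M" unfolding bounded_iff by auto
  have "norm (x (2 * 1 + 1) - x 1) \<ge> \<delta>"
    using tree unfolding delta_tree_def by blast
  then have w: "x (2 * 1 + 1) - x 1 \<noteq> 0" using \<open>\<delta> > 0\<close> by auto
  have "0 \<le> M" using M[of 1] norm_ge_zero[of "x 1"] by linarith
  \<comment> \<open>The nonzero difference supplies a direction; norm \<open>M + 1\<close> against
    members of norm at most \<open>M\<close> leaves at least 1.\<close>
  define z where "z = (M + 1) *\<^sub>R sgn (x (2 * 1 + 1) - x 1)"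
  have z: "norm z = M + 1" using w \<open>0 \<le> M\<close> by (simp add: z_def norm_sgn)
  have "1 \<le> norm (x i + z) \<and> norm (x i + z) \<le> 2 * M + 1" if "i \<ge> 1" for i
    using M[OF that] z norm_triangle_ineq[of "x i" z] norm_diff_ineq[of z "x i"]
    by (simp add: add.commute)
  with delta_tree_translate[OF tree] show ?thesis
    by (rule embedding_if_large_tree[OF \<open>\<delta> > 0\<close>])
qed

theorem theorem1p12:
  "infinite_tree_property TYPE('a::banach) \<longleftrightarrow>
   (\<exists>(C::real) (f :: vertex \<Rightarrow> 'a).
      0 < C \<and> inj_on f D_omega \<and>
      (\<forall>(x, y) \<in> active_pairs.
         D_omega_dist x y \<le> norm (f x - f y) \<and>
         norm (f x - f y) \<le> C * D_omega_dist x y))"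
proof
  assume "infinite_tree_property TYPE('a)"
  then show "\<exists>(C::real) (f :: vertex \<Rightarrow> 'a). 0 < C \<and> inj_on f D_omega \<and>
      (\<forall>(x, y) \<in> active_pairs.
         D_omega_dist x y \<le> norm (f x - f y) \<and> norm (f x - f y) \<le> C * D_omega_dist x y)"
    using embedding_if_tree inj_on_subset[OF _ subset_UNIV] by blast
next
  assume "\<exists>(C::real) (f :: vertex \<Rightarrow> 'a). 0 < C \<and> inj_on f D_omega \<and>
      (\<forall>(x, y) \<in> active_pairs.
         D_omega_dist x y \<le> norm (f x - f y) \<and> norm (f x - f y) \<le> C * D_omega_dist x y)"
  then show "infinite_tree_property TYPE('a)"
    using tree_if_embedding by blast
qed

end
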